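(* Let $a_{-1},a_0,a_1,a_2,b>0$ and $\gamma,\theta>1$ be constants with $\gamma+1\ge2\theta$, let $x_0>0$, and let $\{Y_t\}_{t\ge0}$ be the unique positive global solution of $$dY_t=f(Y_t)\,dt+b(1-\theta)\,dW_t,\qquad Y_0=x_0^{1-\theta}.$$ Then for any $p\ge\frac{\gamma-1}{\theta-1}$, $$\sup_{t\in[0,\infty)}\mathbb E\big[|Y_t|^{p}\big]<\infty.$$
   Context: $\{W_t\}_{t\ge0}$ is a one-dimensional Brownian motion on a filtered probability space $(\Omega,\mathcal F,\{\mathcal F_t\}_{t\ge0},\mathbb P)$ satisfying the usual hypotheses. The drift $f:(0,\infty)\to\mathbb R$ is $$f(x)=(\theta-1)\Big(a_2x^{\frac{\gamma-\theta}{1-\theta}}-a_1x-a_{-1}x^{\frac{\theta+1}{\theta-1}}+a_0x^{\frac{\theta}{\theta-1}}+\tfrac12 b^2\theta x^{-1}\Big).$$ The equation is known to have a unique positive global solution for these parameters. *)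

theory Defs
  imports "HOL-Probability.Probability"
begin

text \<open>
  Processes and filtrations are indexed by \<^typ>\<open>real\<close>; only times \<open>t \<ge> 0\<close> are constrained,
  the values at negative times are irrelevant.
\<close>

locale filtered_prob_space = prob_space M for M :: "'a measure" +
  fixes F :: "real \<Rightarrow> 'a measure"
  assumes subalgebra_F: "\<And>t. 0 \<le> t \<Longrightarrow> subalgebra M (F t)"
    and sets_F_mono: "\<And>s t. 0 \<le> s \<Longrightarrow> s \<le> t \<Longrightarrow> sets (F s) \<subseteq> sets (F t)"

locale usual_filtered_prob_space = filtered_prob_space M F + complete_measure M
  for M :: "'a measure" and F +
  assumes null_sets_F: "null_sets M \<subseteq> sets (F 0)"
    and right_continuous_F: "\<And>t. 0 \<le> t \<Longrightarrow> sets (F t) = (\<Inter>s\<in>{t<..}. sets (F s))"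

definition adapted :: "(real \<Rightarrow> 'a measure) \<Rightarrow> (real \<Rightarrow> 'a \<Rightarrow> real) \<Rightarrow> bool" where
  "adapted F X \<longleftrightarrow> (\<forall>t\<ge>0. X t \<in> borel_measurable (F t))"

locale brownian_motion = filtered_prob_space M F for M :: "'a measure" and F +
  fixes W :: "real \<Rightarrow> 'a \<Rightarrow> real"
  assumes adapted_W: "adapted F W"
    and W_0: "AE \<omega> in M. W 0 \<omega> = 0"
    and continuous_W: "AE \<omega> in M. continuous_on {0..} (\<lambda>t. W t \<omega>)"
    and indep_increments: "\<And>s t. 0 \<le> s \<Longrightarrow> s < t \<Longrightarrow>
      indep_set (sets (F s)) (sets (vimage_algebra (space M) (\<lambda>\<omega>. W t \<omega> - W s \<omega>) borel))"
    and normal_increments: "\<And>s t. 0 \<le> s \<Longrightarrow> s < t \<Longrightarrow>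
      distributed M lborel (\<lambda>\<omega>. W t \<omega> - W s \<omega>) (normal_density 0 (sqrt (t - s)))"

text \<open>
  Positive global (strong) solutions of \<open>dY = g(Y) dt + \<sigma> dW\<close>, \<open>Y\<^sub>0 = y0\<close>, with a constant
  diffusion coefficient \<open>\<sigma>\<close>.  The stochastic integral of the constant (hence simple) integrand
  \<open>\<sigma>\<close> over \<open>[0, t]\<close> is by definition \<open>\<sigma> (W\<^sub>t - W\<^sub>0)\<close>.
\<close>

definition positive_global_solution ::
  "'a measure \<Rightarrow> (real \<Rightarrow> 'a measure) \<Rightarrow> (real \<Rightarrow> 'a \<Rightarrow> real) \<Rightarrow> (real \<Rightarrow> real) \<Rightarrow> real \<Rightarrow> real
    \<Rightarrow> (real \<Rightarrow> 'a \<Rightarrow> real) \<Rightarrow> bool" where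
  "positive_global_solution M F W g \<sigma> y0 Y \<longleftrightarrow>
     adapted F Y \<and>
     (AE \<omega> in M.
        Y 0 \<omega> = y0 \<and>
        continuous_on {0..} (\<lambda>t. Y t \<omega>) \<and>
        (\<forall>t\<ge>0. 0 < Y t \<omega> \<and>
               set_integrable lborel {0..t} (\<lambda>s. g (Y s \<omega>)) \<and>
               Y t \<omega> = Y 0 \<omega> + (LINT s:{0..t}|lborel. g (Y s \<omega>)) + \<sigma> * (W t \<omega> - W 0 \<omega>)))"

text \<open>Only the values at \<open>x > 0\<close> are meaningful; \<open>am1\<close> is the constant \<open>a\<close> with index \<open>-1\<close>.\<close>

definition drift :: "real \<Rightarrow> real \<Rightarrow> real \<Rightarrow> real \<Rightarrow> real \<Rightarrow> real \<Rightarrow> real \<Rightarrow> real \<Rightarrow> real" where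
  "drift am1 a0 a1 a2 b \<gamma> \<theta> x =
     (\<theta> - 1) * (a2 * x powr ((\<gamma> - \<theta>) / (1 - \<theta>)) - a1 * x
       - am1 * x powr ((\<theta> + 1) / (\<theta> - 1)) + a0 * x powr (\<theta> / (\<theta> - 1))
       + 1 / 2 * b\<^sup>2 * \<theta> * inverse x)"

end

theory Submission
  imports Defs
begin

text \<open>
  The noise is additive, so the equation can be read path by path, as an integral equation driven
  by the continuous function \<open>z t = b (1 - \<theta>) (W t - W 0)\<close>.  For \<open>x \<ge> 1\<close> the term with
  the constant \<open>am1\<close> dominates, up to a constant, the one with \<open>a0\<close>, and the singular terms are bounded, which leaves \<open>drift x \<le> C - l x\<close> with \<open>l = (\<theta> - 1) a1 > 0\<close>
  (\<open>drift_le_linear\<close>).  The drift is unbounded near \<open>0\<close>, but there a path is small anyway: a path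
  is controlled from the last time at which it was at most \<open>1\<close>.

  Over a unit of time this gives \<open>Y (a + 1) \<le> \<rho> Y a + A\<close>, where \<open>\<rho> = 1 / (1 + l) < 1\<close> and
  \<open>A\<close> is a constant plus a multiple of the oscillation of \<open>W\<close> on \<open>[a, a + 1]\<close>
  (\<open>unit_step_contraction\<close>).  Convexity of an even power \<open>q\<close> turns this into
  \<open>E (Y (a + 1))^q \<le> \<rho> E (Y a)^q + K\<close>, and iteration bounds \<open>E (Y t)^q\<close> uniformly
  in \<open>t\<close>, provided the \<open>q\<close>-th moment of the oscillation is bounded uniformly in \<open>a\<close>.

  The latter is a dyadic chaining argument.  The oscillation is bounded by a geometric series of
  increments along dyadic grids (\<open>dyadic_chaining\<close>); the sum of the rescaled \<open>q\<close>-th powers of all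
  these increments has finite expectation for even \<open>q \<ge> 12\<close>, by the Gaussian moment formula
  (\<open>nn_integral_dyadic_functional\<close>).  Since \<open>x\<^sup>p \<le> 1 + x\<^sup>q\<close> for \<open>0 \<le> p \<le> q\<close>, large even
  powers suffice.
\<close>

section \<open>Linear bound on the drift\<close>

text \<open>
  In terms of \<open>u = x powr (1 / (\<theta> - 1))\<close> the two growing terms are
  \<open>a0 u powr \<theta> - am1 u powr (\<theta> + 1)\<close>, which is negative once \<open>u > a0 / am1\<close>.  The
  remaining powers of \<open>x\<close>, except the linear one, have exponents \<open>\<le> 0\<close>.
\<close>

lemma drift_le_linear:
  fixes am1 a0 a1 a2 b \<gamma> \<theta> :: real
  assumes "am1 > 0" "a0 > 0" "a2 > 0" "\<theta> > 1" "\<gamma> \<ge> \<theta>"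
  obtains C where "C \<ge> 0"
    "\<And>x. 1 \<le> x \<Longrightarrow> drift am1 a0 a1 a2 b \<gamma> \<theta> x \<le> C - (\<theta> - 1) * a1 * x"
proof
  define Q where "Q = max 1 (a0 / am1)"
  define C where "C = (\<theta> - 1) * (a2 + a0 * Q powr \<theta> + 1 / 2 * b\<^sup>2 * \<theta>)"
  have "0 \<le> a2 + a0 * Q powr \<theta> + 1 / 2 * b\<^sup>2 * \<theta>"
    using assms by (intro add_nonneg_nonneg) auto
  then show "C \<ge> 0" using assms by (simp add: C_def)
  fix x :: real assume x: "1 \<le> x"
  define u where "u = x powr (1 / (\<theta> - 1))"
  have u: "u > 0" using x by (simp add: u_def)
  have pow_u: "x powr (\<theta> / (\<theta> - 1)) = u powr \<theta>"
    using assms x by (simp add: u_def powr_powr)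
  have pow_u1: "x powr ((\<theta> + 1) / (\<theta> - 1)) = u powr \<theta> * u"
  proof -
    have "u powr \<theta> * u = u powr (\<theta> + 1)" using u by (simp add: powr_add)
    also have "\<dots> = x powr ((\<theta> + 1) / (\<theta> - 1))" using assms x by (simp add: u_def powr_powr)
    finally show ?thesis by simp
  qed
  have "a0 * u powr \<theta> - am1 * (u powr \<theta> * u) \<le> a0 * Q powr \<theta>"
  proof (cases "u \<le> Q")
    case True
    have "a0 * u powr \<theta> \<le> a0 * Q powr \<theta>"
      using True u assms by (intro mult_left_mono powr_mono2) auto
    moreover have "0 \<le> am1 * (u powr \<theta> * u)" using u assms by simp
    ultimately show ?thesis by linarith
  next
    case False
    then have "a0 / am1 \<le> u" by (simp add: Q_def)
    then have "a0 \<le> am1 * u" using assms by (simp add: field_simps)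
    then have "a0 * u powr \<theta> \<le> (am1 * u) * u powr \<theta>" by (intro mult_right_mono) auto
    moreover have "0 \<le> a0 * Q powr \<theta>" using assms by simp
    ultimately show ?thesis by (simp add: algebra_simps)
  qed
  moreover have "a2 * x powr ((\<gamma> - \<theta>) / (1 - \<theta>)) \<le> a2 * 1"
  proof (intro mult_left_mono)
    have "x powr ((\<gamma> - \<theta>) / (1 - \<theta>)) \<le> x powr 0"
      using assms x by (intro powr_mono) (auto intro: divide_nonneg_neg)
    then show "x powr ((\<gamma> - \<theta>) / (1 - \<theta>)) \<le> 1" using x by simp
  qed (use assms in simp)
  moreover have "1 / 2 * b\<^sup>2 * \<theta> * inverse x \<le> 1 / 2 * b\<^sup>2 * \<theta> * 1"
    using assms x by (intro mult_left_mono) (auto simp: field_simps)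
  ultimately have "a2 * x powr ((\<gamma> - \<theta>) / (1 - \<theta>)) - a1 * x
       - am1 * x powr ((\<theta> + 1) / (\<theta> - 1)) + a0 * x powr (\<theta> / (\<theta> - 1))
       + 1 / 2 * b\<^sup>2 * \<theta> * inverse x
      \<le> (a2 + a0 * Q powr \<theta> + 1 / 2 * b\<^sup>2 * \<theta>) - a1 * x"
    unfolding pow_u pow_u1 by linarith
  then have "drift am1 a0 a1 a2 b \<gamma> \<theta> x
      \<le> (\<theta> - 1) * ((a2 + a0 * Q powr \<theta> + 1 / 2 * b\<^sup>2 * \<theta>) - a1 * x)"
    unfolding drift_def using assms by (intro mult_left_mono) auto
  then show "drift am1 a0 a1 a2 b \<gamma> \<theta> x \<le> C - (\<theta> - 1) * a1 * x"
    by (simp add: C_def algebra_simps)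
qed

section \<open>Oscillation of a continuous function on dyadic grids\<close>

text \<open>
  A point of the level \<open>n + 1\<close> grid is a point of the level \<open>n\<close> grid or one increment
  away from it, so on the grids the distance to \<open>w a\<close> is at most the sum of the increment bounds, and
  \<open>4\<close> is the sum of the geometric series with ratio \<open>3 / 4\<close>.  Continuity covers the other points.
  The ratio has to exceed \<open>1 / sqrt 2\<close>, the rate at which Brownian increments shrink.
\<close>

lemma dyadic_chaining:
  fixes w :: "real \<Rightarrow> real"
  assumes cont: "continuous_on {a..a + 1} w"
    and inc: "\<And>n k. k < 2 ^ n \<Longrightarrow>
      \<bar>w (a + real (Suc k) / 2 ^ n) - w (a + real k / 2 ^ n)\<bar> \<le> L * (3 / 4) ^ n"
    and s: "s \<in> {a..a + 1}"
  shows "\<bar>w s - w a\<bar> \<le> 4 * L"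
proof -
  have L: "0 \<le> L" using inc[of 0 0] by simp
  have grid: "\<bar>w (a + real k / 2 ^ n) - w a\<bar> \<le> L * (\<Sum>j\<le>n. (3 / 4) ^ j)" if "k \<le> 2 ^ n" for n k
    using that
  proof (induction n arbitrary: k)
    case 0
    then have "k = 0 \<or> k = 1" by auto
    then show ?case using inc[of 0 0] L by auto
  next
    case (Suc n)
    define j where "j = k div 2"
    have j: "j \<le> 2 ^ n" using Suc.prems by (simp add: j_def)
    have half: "real (2 * j) / 2 ^ Suc n = real j / 2 ^ n" by simp
    have IH: "\<bar>w (a + real (2 * j) / 2 ^ Suc n) - w a\<bar> \<le> L * (\<Sum>j\<le>n. (3 / 4) ^ j)"
      using Suc.IH[OF j] unfolding half .
    have sum: "L * (\<Sum>j\<le>Suc n. (3 / 4) ^ j) = L * (\<Sum>j\<le>n. (3 / 4) ^ j) + L * (3 / 4) ^ Suc n"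
      by (simp add: distrib_left)
    have nn: "0 \<le> L * (3 / 4) ^ Suc n" using L by simp
    show ?case
    proof (cases "even k")
      case True
      then have k: "k = 2 * j" by (simp add: j_def)
      show ?thesis unfolding k using IH sum nn by linarith
    next
      case False
      then have k: "k = Suc (2 * j)" by (simp add: j_def)
      have "2 * j < 2 ^ Suc n" using Suc.prems k by simp
      from inc[OF this] IH sum show ?thesis unfolding k by linarith
    qed
  qed
  have le4: "L * (\<Sum>j\<le>n. (3 / 4) ^ j) \<le> 4 * L" for n
  proof -
    have "(\<Sum>j\<le>n. (3 / 4) ^ j) \<le> (4::real)"
      by (simp add: sum_gp0)
    then show ?thesis using L by (metis mult.commute mult_right_mono)
  qed
  define d where "d n = nat \<lfloor>(s - a) * 2 ^ n\<rfloor>" for n :: nat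
  have d_le: "real (d n) \<le> (s - a) * 2 ^ n" and d_gt: "(s - a) * 2 ^ n < real (d n) + 1" for n
    using s by (auto simp: d_def)
  have d_grid: "d n \<le> 2 ^ n" for n
  proof -
    have "(s - a) * 2 ^ n \<le> 1 * 2 ^ n" using s by (intro mult_right_mono) auto
    then have "real (d n) \<le> real (2 ^ n)"
      unfolding of_nat_power of_nat_numeral using d_le[of n] by linarith
    then show ?thesis by (simp only: of_nat_le_iff)
  qed
  have lim: "(\<lambda>n. a + real (d n) / 2 ^ n) \<longlonglongrightarrow> s"
  proof (rule real_tendsto_sandwich[of "\<lambda>n. s - (1 / 2) ^ n" _ _ "\<lambda>n. s"])
    show "\<forall>\<^sub>F n in sequentially. s - (1 / 2) ^ n \<le> a + real (d n) / 2 ^ n"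
    proof (intro always_eventually allI)
      fix n
      have "s - a \<le> (real (d n) + 1) / 2 ^ n" using d_gt[of n] by (simp add: field_simps)
      then show "s - (1 / 2) ^ n \<le> a + real (d n) / 2 ^ n"
        by (simp add: power_divide add_divide_distrib)
    qed
    show "\<forall>\<^sub>F n in sequentially. a + real (d n) / 2 ^ n \<le> s"
    proof (intro always_eventually allI)
      fix n
      have "real (d n) / 2 ^ n \<le> s - a" using d_le[of n] by (simp add: field_simps)
      then show "a + real (d n) / 2 ^ n \<le> s" by simp
    qed
    have "(\<lambda>n. s - (1 / 2) ^ n) \<longlonglongrightarrow> s - 0"
      by (intro tendsto_intros LIMSEQ_power_zero) auto
    then show "(\<lambda>n. s - (1 / 2) ^ n) \<longlonglongrightarrow> s" by simp
  qed simp
  have "(\<lambda>n. w (a + real (d n) / 2 ^ n)) \<longlonglongrightarrow> w s"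
  proof (rule continuous_on_tendsto_compose[OF cont lim s])
    show "\<forall>\<^sub>F n in sequentially. a + real (d n) / 2 ^ n \<in> {a..a + 1}"
      using d_grid
      by (intro always_eventually) (auto simp: field_simps of_nat_le_numeral_power_cancel_iff)
  qed
  then have "(\<lambda>n. \<bar>w (a + real (d n) / 2 ^ n) - w a\<bar>) \<longlonglongrightarrow> \<bar>w s - w a\<bar>"
    by (intro tendsto_intros)
  then show ?thesis
    by (rule LIMSEQ_le_const2) (use grid[OF d_grid] le4 in \<open>meson order_trans\<close>)
qed

section \<open>Paths driven by a damped drift\<close>

text \<open>
  The starting time \<open>s\<close> stands in for the last visit below \<open>c\<close> when there is none, which is why
  \<open>y s\<close> enters the bound.
\<close>

lemma last_below_or_start:
  fixes y :: "real \<Rightarrow> real"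
  assumes cont: "continuous_on {s..u} y" and "s \<le> u"
  obtains r where "r \<in> {s..u}" "y r \<le> max c (y s)" "\<And>v. v \<in> {r<..u} \<Longrightarrow> c < y v"
proof -
  define T where "T = {s} \<union> {v \<in> {s..u}. y v \<le> c}"
  have "closed {v \<in> {s..u}. y v \<le> c}"
    by (intro continuous_on_closed_Collect_le continuous_intros cont)
  then have T: "compact T" "T \<noteq> {}" "T \<subseteq> {s..u}"
    using \<open>s \<le> u\<close> unfolding T_def
    by (auto intro!: compact_Un simp: compact_eq_bounded_closed
        intro: bounded_subset[OF bounded_closed_interval[of s u]])
  obtain r where r: "r \<in> T" "\<And>v. v \<in> T \<Longrightarrow> v \<le> r"
    using compact_attains_sup[OF T(1,2)] by blast
  show thesis
  proof (rule that[of r])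
    show "r \<in> {s..u}" using r T by blast
    show "y r \<le> max c (y s)" using r(1) by (auto simp: T_def)
    show "c < y v" if "v \<in> {r<..u}" for v
      using that r(2)[of v] \<open>r \<in> {s..u}\<close> by (force simp: T_def)
  qed
qed

text \<open>
  One path \<open>y\<close> of the solution, with \<open>z\<close> the noise along it.  The drift bound is imposed only above
  level \<open>1\<close>, so that \<open>g\<close> may explode at \<open>0\<close>.
\<close>

locale damped_path =
  fixes g y z :: "real \<Rightarrow> real" and C l :: real
  assumes C_nonneg: "0 \<le> C" and l_nonneg: "0 \<le> l"
    and drift_bound: "\<And>x. 1 \<le> x \<Longrightarrow> g x \<le> C - l * x"
    and y_continuous: "continuous_on {0..} y"
    and y_pos: "\<And>t. 0 \<le> t \<Longrightarrow> 0 < y t"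
    and g_integrable: "\<And>t. 0 \<le> t \<Longrightarrow> set_integrable lborel {0..t} (\<lambda>s. g (y s))"
    and equation: "\<And>t. 0 \<le> t \<Longrightarrow> y t = y 0 + (LINT s:{0..t}|lborel. g (y s)) + z t"
begin

text \<open>
  The half-open interval is empty for \<open>s = u\<close>.  This covers a path that ends at a last visit to
  \<open>y \<le> 1\<close>, possibly at a point where the drift is large.
\<close>

lemma increment_le:
  assumes "0 \<le> s" "s \<le> u" and bound: "\<And>r. r \<in> {s<..u} \<Longrightarrow> g (y r) \<le> v"
  shows "y u - y s \<le> v * (u - s) + (z u - z s)"
proof -
  have int: "set_integrable lborel {s<..u} (\<lambda>r. g (y r))"
    by (rule set_integrable_subset[OF g_integrable[of u]]) (use assms in auto)
  have "{0..u} = {0..s} \<union> {s<..u}" using assms by auto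
  then have "(LINT r:{0..u}|lborel. g (y r))
      = (LINT r:{0..s}|lborel. g (y r)) + (LINT r:{s<..u}|lborel. g (y r))"
    using set_integral_Un[OF _ g_integrable[OF \<open>0 \<le> s\<close>] int] by (simp add: ivl_disj_int)
  moreover have "(LINT r:{s<..u}|lborel. g (y r)) \<le> (LINT r:{s<..u}|lborel. v)"
    by (rule set_integral_mono[OF int]) (use bound \<open>s \<le> u\<close> in \<open>auto simp: set_integrable_def\<close>)
  moreover have "(LINT r:{s<..u}|lborel. v) = v * (u - s)"
    using \<open>s \<le> u\<close> by (simp add: set_lebesgue_integral_def)
  ultimately show ?thesis using equation[of u] equation[of s] assms by linarith
qed

text \<open>
  After its last visit to \<open>y \<le> 1\<close>, or after time \<open>s\<close> if there is no such visit, the path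
  has drift at most \<open>C\<close>.
\<close>

lemma crude_bound:
  assumes "0 \<le> s" "s \<le> u" "u \<le> s + 1"
    and noise: "\<And>r. r \<in> {s..u} \<Longrightarrow> \<bar>z u - z r\<bar> \<le> D"
  shows "y u \<le> max 1 (y s) + C + D"
proof -
  have "continuous_on {s..u} y"
    by (rule continuous_on_subset[OF y_continuous]) (use assms in auto)
  then obtain r where r: "r \<in> {s..u}" "y r \<le> max 1 (y s)"
    and above: "\<And>v. v \<in> {r<..u} \<Longrightarrow> 1 < y v"
    using last_below_or_start[OF _ \<open>s \<le> u\<close>] by metis
  have "y u - y r \<le> C * (u - r) + (z u - z r)"
  proof (rule increment_le)
    fix v assume "v \<in> {r<..u}"
    then have "1 < y v" by (rule above)
    moreover from this have "0 \<le> l * y v" using l_nonneg by simp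
    ultimately show "g (y v) \<le> C" using drift_bound[of "y v"] by linarith
  qed (use r assms in auto)
  moreover have "C * (u - r) \<le> C * 1"
    using r assms C_nonneg by (intro mult_left_mono) auto
  ultimately show ?thesis using r noise[OF r(1)] by linarith
qed

text \<open>
  Let \<open>s\<close> be a time of minimum.  If the minimum is at most \<open>1\<close>, then the end value is bounded by the
  crude bound started at \<open>s\<close>.  Otherwise the drift is at most \<open>C - l y s\<close> throughout, so the path
  loses \<open>l y s\<close> up to a constant and noise; since \<open>y (a + 1)\<close> exceeds \<open>y s\<close> by at most a constant
  and noise, it loses \<open>l y (a + 1)\<close> as well, which yields the factor \<open>1 / (1 + l)\<close>.
\<close>

lemma unit_step_contraction:
  assumes "0 \<le> a" and noise: "\<And>s. s \<in> {a..a + 1} \<Longrightarrow> \<bar>z s - z a\<bar> \<le> S"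
  shows "y (a + 1) \<le> 1 / (1 + l) * y a + (1 + C + 2 * S)"
proof -
  have S: "0 \<le> S" using noise[of a] by simp
  have end_le: "y (a + 1) \<le> max 1 (y s) + C + 2 * S" if s: "s \<in> {a..a + 1}" for s
  proof (rule crude_bound)
    show "\<bar>z (a + 1) - z r\<bar> \<le> 2 * S" if "r \<in> {s..a + 1}" for r
      using noise[of r] noise[of "a + 1"] that s by auto
  qed (use s \<open>0 \<le> a\<close> in auto)
  have pos: "0 < 1 / (1 + l) * y a" using y_pos \<open>0 \<le> a\<close> l_nonneg by simp
  have "continuous_on {a..a + 1} y"
    by (rule continuous_on_subset[OF y_continuous]) (use assms in auto)
  then obtain s where s: "s \<in> {a..a + 1}" and min: "\<And>r. r \<in> {a..a + 1} \<Longrightarrow> y s \<le> y r"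
    using continuous_attains_inf[of "{a..a + 1}" y] by auto
  show ?thesis
  proof (cases "y s \<le> 1")
    case True
    then show ?thesis using end_le[OF s] pos by simp
  next
    case False
    have "y (a + 1) - y a \<le> (C - l * y s) * ((a + 1) - a) + (z (a + 1) - z a)"
    proof (rule increment_le)
      fix r assume "r \<in> {a<..a + 1}"
      then have r: "y s \<le> y r" by (intro min) auto
      have "l * y s \<le> l * y r" using r l_nonneg by (rule mult_left_mono)
      then show "g (y r) \<le> C - l * y s" using drift_bound[of "y r"] r False by linarith
    qed (use \<open>0 \<le> a\<close> in auto)
    then have descent: "y (a + 1) \<le> y a + C - l * y s + S"
      using noise[of "a + 1"] by auto
    have "l * y (a + 1) \<le> l * (y s + C + 2 * S)"
      using end_le[OF s] False l_nonneg by (intro mult_left_mono) auto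
    then have "(1 + l) * y (a + 1) \<le> y a + (1 + l) * (1 + C + 2 * S)"
      using descent S l_nonneg by (simp add: algebra_simps)
    then show ?thesis using l_nonneg by (simp add: field_simps)
  qed
qed

lemma unit_interval_bound:
  assumes "0 \<le> a" and noise: "\<And>s. s \<in> {a..a + 1} \<Longrightarrow> \<bar>z s - z a\<bar> \<le> S"
    and u: "u \<in> {a..a + 1}"
  shows "y u \<le> y a + (1 + C + 2 * S)"
proof -
  have "y u \<le> max 1 (y a) + C + 2 * S"
  proof (rule crude_bound)
    show "\<bar>z u - z r\<bar> \<le> 2 * S" if "r \<in> {a..u}" for r
      using noise[of r] noise[of u] that u by auto
  qed (use u \<open>0 \<le> a\<close> in auto)
  then show ?thesis using y_pos[OF \<open>0 \<le> a\<close>] by linarith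
qed

end

section \<open>Inequalities for even powers\<close>

text \<open>
  Reading \<open>\<rho> x + A\<close> as a convex combination of \<open>x\<close> and \<open>A / (1 - \<rho>)\<close> keeps the
  coefficient of \<open>x ^ q\<close> equal to \<open>\<rho> < 1\<close>; a bound of the form \<open>2 ^ q (\<dots>)\<close> would not.
\<close>

lemma convexity_split:
  fixes x A \<rho> :: real
  assumes "0 < \<rho>" "\<rho> < 1" "even q"
  shows "(\<rho> * x + A) ^ q \<le> \<rho> * x ^ q + (1 - \<rho>) * (A / (1 - \<rho>)) ^ q"
  using convex_onD[OF convex_power_even[OF \<open>even q\<close>], of "1 - \<rho>" x "A / (1 - \<rho>)"] assms
  by simp

lemma power_add_le:
  fixes x y :: real
  assumes "even q"
  shows "(x + y) ^ q \<le> 2 ^ q * (x ^ q + y ^ q)"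
proof -
  have "(x + y) ^ q = 2 ^ q * (1 / 2 * x + 1 / 2 * y) ^ q"
    by (simp flip: power_mult_distrib)
  also have "(1 / 2 * x + 1 / 2 * y) ^ q \<le> 1 / 2 * x ^ q + 1 / 2 * y ^ q"
    using convex_onD[OF convex_power_even[OF assms], of "1 / 2" x y] by simp
  also have "\<dots> \<le> x ^ q + y ^ q"
    using zero_le_even_power[OF assms, of x] zero_le_even_power[OF assms, of y] by linarith
  finally show ?thesis by simp
qed

section \<open>Moments of the oscillation of Brownian motion\<close>

text \<open>
  For even \<open>q > 0\<close>, a measurable upper bound for \<open>(v / 4) ^ q\<close>, where \<open>v\<close> is the oscillation of \<open>W\<close>
  around \<open>W a\<close> on \<open>[a, a + 1]\<close>: a finite value \<open>R\<close> bounds every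
  increment at level \<open>n\<close> by \<open>root q R * (3 / 4) ^ n\<close>, as the chaining lemma requires.
\<close>

definition (in brownian_motion) dyadic_functional :: "nat \<Rightarrow> real \<Rightarrow> 'a \<Rightarrow> ennreal" where
  "dyadic_functional q a \<omega> = (\<Sum>n. \<Sum>k<2 ^ n. ennreal
     (((4 / 3) ^ n * (W (a + real (Suc k) / 2 ^ n) \<omega> - W (a + real k / 2 ^ n) \<omega>)) ^ q))"

context brownian_motion
begin

lemma W_measurable: "0 \<le> t \<Longrightarrow> W t \<in> borel_measurable M"
  using adapted_W subalgebra_F[of t] measurable_from_subalg unfolding adapted_def by blast

lemma W_measurable':
  "0 \<le> a \<Longrightarrow> (\<lambda>\<omega>. W (a + real k / 2 ^ n) \<omega>) \<in> borel_measurable M"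
  by (rule W_measurable) simp

lemma dyadic_functional_measurable:
  assumes "0 \<le> a"
  shows "dyadic_functional q a \<in> borel_measurable M"
proof -
  note [measurable] = W_measurable'[OF assms]
  show ?thesis unfolding dyadic_functional_def[abs_def] by measurable
qed

lemma increment_even_moment:
  assumes "0 \<le> s" "s < t"
  shows "(\<integral>\<^sup>+ \<omega>. ennreal ((c * (W t \<omega> - W s \<omega>)) ^ (2 * m)) \<partial>M)
    = ennreal (fact (2 * m) / (2 ^ m * fact m) * (c\<^sup>2 * (t - s)) ^ m)"
proof -
  let ?d = "normal_density 0 (sqrt (t - s))"
  have sd: "0 < sqrt (t - s)" using assms by simp
  have "(\<integral>\<^sup>+ \<omega>. ennreal ((c * (W t \<omega> - W s \<omega>)) ^ (2 * m)) \<partial>M)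
      = (\<integral>\<^sup>+ x. ennreal (?d x) * ennreal ((c * x) ^ (2 * m)) \<partial>lborel)"
    by (rule distributed_nn_integral[OF normal_increments[OF assms], symmetric]) simp
  also have "\<dots> = (\<integral>\<^sup>+ x. ennreal (c ^ (2 * m) * (?d x * (x - 0) ^ (2 * m))) \<partial>lborel)"
    by (intro nn_integral_cong)
       (simp add: power_mult_distrib mult_ac flip: ennreal_mult')
  also have "\<dots> = ennreal (c ^ (2 * m) * (fact (2 * m) / ((2 / (sqrt (t - s))\<^sup>2) ^ m * fact m)))"
    using nn_integral_eq_integral[OF integrable.intros[OF has_bochner_integral_mult_right[OF
          normal_moment_even[OF sd, of 0 m], of "c ^ (2 * m)"]]]
    by (simp add: integral_normal_moment_even[OF sd, of 0 m, simplified])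
  also have "c ^ (2 * m) * (fact (2 * m) / ((2 / (sqrt (t - s))\<^sup>2) ^ m * fact m))
      = fact (2 * m) / (2 ^ m * fact m) * (c\<^sup>2 * (t - s)) ^ m"
    using assms by (simp add: power_mult power_mult_distrib power_divide)
  finally show ?thesis .
qed

text \<open>
  At level \<open>n\<close> there are \<open>2 ^ n\<close> increments of variance \<open>2 ^ -n\<close>, and scaling by \<open>(4 / 3) ^ n\<close>
  changes the variance to \<open>((16 / 9) / 2) ^ n = (8 / 9) ^ n\<close>.  The level thus contributes a multiple
  of \<open>(2 (8 / 9) ^ m) ^ n\<close>, and \<open>m = 6\<close> is the first exponent for which this series converges.
\<close>

lemma nn_integral_dyadic_functional:
  assumes "0 \<le> a" and m: "6 \<le> m"
  shows "(\<integral>\<^sup>+ \<omega>. dyadic_functional (2 * m) a \<omega> \<partial>M)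
    \<le> ennreal (fact (2 * m) / (2 ^ m * fact m) * (1 / (1 - 2 * (8 / 9) ^ m)))"
proof -
  note [measurable] = W_measurable'[OF \<open>0 \<le> a\<close>]
  define c :: real where "c = fact (2 * m) / (2 ^ m * fact m)"
  define \<kappa> :: real where "\<kappa> = 2 * (8 / 9) ^ m"
  have c: "0 \<le> c" by (simp add: c_def)
  have \<kappa>: "0 \<le> \<kappa>" "\<kappa> < 1"
  proof -
    have "(8 / 9 :: real) ^ m \<le> (8 / 9) ^ 6" by (intro power_decreasing m) auto
    also have "\<dots> < 1 / 2" by (simp add: power_divide)
    finally show "\<kappa> < 1" by (simp add: \<kappa>_def)
  qed (simp add: \<kappa>_def)
  have cell: "(\<integral>\<^sup>+ \<omega>. ennreal (((4 / 3) ^ n * (W (a + real (Suc k) / 2 ^ n) \<omega>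
      - W (a + real k / 2 ^ n) \<omega>)) ^ (2 * m)) \<partial>M) = ennreal (c * ((8 / 9) ^ m) ^ n)" for n k
  proof -
    have "((4 / 3) ^ n)\<^sup>2 * ((a + real (Suc k) / 2 ^ n) - (a + real k / 2 ^ n))
        = ((4 / 3)\<^sup>2 * (1 / 2)) ^ n"
      unfolding power_mult_distrib power_mult[symmetric] mult.commute[of 2 n]
      by (simp add: add_divide_distrib power_divide)
    also have "\<dots> = (8 / 9 :: real) ^ n"
      by (simp add: power2_eq_square)
    finally have scale: "((4 / 3) ^ n)\<^sup>2 * ((a + real (Suc k) / 2 ^ n) - (a + real k / 2 ^ n))
        = (8 / 9) ^ n" .
    have "0 \<le> a + real k / 2 ^ n" "a + real k / 2 ^ n < a + real (Suc k) / 2 ^ n"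
      using \<open>0 \<le> a\<close> by (auto simp: divide_strict_right_mono)
    note increment_even_moment[OF this, of "(4 / 3) ^ n" m, unfolded scale, folded c_def]
    then show ?thesis by (simp only: mult.commute[of n m] flip: power_mult)
  qed
  have "(\<integral>\<^sup>+ \<omega>. dyadic_functional (2 * m) a \<omega> \<partial>M)
      = (\<Sum>n. \<Sum>k<(2::nat) ^ n. ennreal (c * ((8 / 9) ^ m) ^ n))"
    unfolding dyadic_functional_def
    by (subst nn_integral_suminf, measurable) (subst nn_integral_sum, simp_all add: cell del: of_nat_Suc)
  also have "\<dots> = (\<Sum>n. ennreal (c * \<kappa> ^ n))"
  proof (intro suminf_cong)
    fix n
    have "(\<Sum>k<(2::nat) ^ n. ennreal (c * ((8 / 9) ^ m) ^ n))
        = ennreal (2 ^ n) * ennreal (c * ((8 / 9) ^ m) ^ n)"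
      by (simp add: ennreal_power[symmetric])
    also have "\<dots> = ennreal (c * \<kappa> ^ n)"
      by (simp add: \<kappa>_def power_mult_distrib mult_ac flip: ennreal_mult')
    finally show "(\<Sum>k<(2::nat) ^ n. ennreal (c * ((8 / 9) ^ m) ^ n)) = ennreal (c * \<kappa> ^ n)" .
  qed
  also have "\<dots> = ennreal (c * (1 / (1 - \<kappa>)))"
    using c \<kappa> geometric_sums[of \<kappa>]
    by (intro suminf_ennreal_eq sums_mult) auto
  finally show ?thesis by (simp add: c_def \<kappa>_def)
qed

lemma oscillation_le_dyadic_functional:
  assumes "continuous_on {a..a + 1} (\<lambda>t. W t \<omega>)" "s \<in> {a..a + 1}" "even q" "0 < q"
  shows "ennreal ((\<bar>W s \<omega> - W a \<omega>\<bar> / 4) ^ q) \<le> dyadic_functional q a \<omega>"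
proof (cases "dyadic_functional q a \<omega> = \<infinity>")
  case False
  define R where "R = enn2real (dyadic_functional q a \<omega>)"
  have R: "dyadic_functional q a \<omega> = ennreal R" "0 \<le> R"
    using False by (auto simp: R_def less_top)
  define L where "L = root q R"
  have L: "0 \<le> L" "L ^ q = R"
    using R \<open>0 < q\<close> by (auto simp: L_def)
  have "\<bar>W s \<omega> - W a \<omega>\<bar> \<le> 4 * L"
  proof (rule dyadic_chaining[OF assms(1) _ assms(2)])
    fix n k :: nat assume k: "k < 2 ^ n"
    define \<Delta> where "\<Delta> = W (a + real (Suc k) / 2 ^ n) \<omega> - W (a + real k / 2 ^ n) \<omega>"
    let ?f = "\<lambda>n k. ennreal (((4 / 3) ^ n *
       (W (a + real (Suc k) / 2 ^ n) \<omega> - W (a + real k / 2 ^ n) \<omega>)) ^ q)"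
    have "?f n k \<le> (\<Sum>k<2 ^ n. ?f n k)"
      using k by (intro member_le_sum) auto
    also have "\<dots> \<le> (\<Sum>n. \<Sum>k<2 ^ n. ?f n k)"
      using sum_le_suminf[of "\<lambda>n. \<Sum>k<2 ^ n. ?f n k" "{n}"] by simp
    also have "\<dots> = ennreal R" using R by (simp add: dyadic_functional_def)
    finally have "((4 / 3) ^ n * \<Delta>) ^ q \<le> R"
      using R by (simp add: \<Delta>_def)
    then have "\<bar>(4 / 3) ^ n * \<Delta>\<bar> ^ q \<le> L ^ q" using L \<open>even q\<close> by (simp add: power_even_abs)
    then have "\<bar>(4 / 3) ^ n * \<Delta>\<bar> \<le> L"
      using L(1) \<open>0 < q\<close> by (rule_tac power_le_imp_le_base[of _ "q - 1"]) auto
    then have "(4 / 3) ^ n * \<bar>\<Delta>\<bar> \<le> L" by (simp add: abs_mult)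
    then have "\<bar>\<Delta>\<bar> \<le> L * (3 / 4) ^ n" by (simp add: field_simps)
    then show "\<bar>W (a + real (Suc k) / 2 ^ n) \<omega> - W (a + real k / 2 ^ n) \<omega>\<bar> \<le> L * (3 / 4) ^ n"
      by (simp add: \<Delta>_def)
  qed
  then have "(\<bar>W s \<omega> - W a \<omega>\<bar> / 4) ^ q \<le> L ^ q" by (intro power_mono) auto
  then show ?thesis using R L by (simp add: ennreal_leI)
qed simp

end

section \<open>Uniform moment bounds\<close>

lemma bounded_of_contraction:
  fixes \<phi> :: "real \<Rightarrow> ennreal"
  assumes \<rho>: "0 \<le> \<rho>" "\<rho> < 1" and K: "0 \<le> K"
    and start: "\<And>t. t \<in> {0..1} \<Longrightarrow> \<phi> t \<le> ennreal K"
    and step: "\<And>t. 0 \<le> t \<Longrightarrow> \<phi> (t + 1) \<le> ennreal \<rho> * \<phi> t + ennreal K"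
    and "0 \<le> t"
  shows "\<phi> t \<le> ennreal (K / (1 - \<rho>))"
proof -
  define B where "B = K / (1 - \<rho>)"
  have B: "0 \<le> B" "\<rho> * B + K = B" using \<rho> K by (auto simp: B_def field_simps)
  then have "K \<le> B" using mult_nonneg_nonneg[OF \<rho>(1) B(1)] by linarith
  have shift: "\<phi> (u + real n) \<le> ennreal B" if u: "u \<in> {0..1}" for u n
  proof (induction n)
    case 0
    show ?case using start[OF u] ennreal_leI[OF \<open>K \<le> B\<close>] by simp
  next
    case (Suc n)
    have "\<phi> (u + real (Suc n)) \<le> ennreal \<rho> * \<phi> (u + real n) + ennreal K"
      using step[of "u + real n"] u by (simp add: add_ac)
    also have "\<dots> \<le> ennreal \<rho> * ennreal B + ennreal K"
      by (intro add_mono mult_left_mono Suc) auto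
    also have "\<dots> = ennreal B" using B \<rho> K by (simp flip: ennreal_mult ennreal_plus)
    finally show ?case .
  qed
  define n where "n = nat \<lfloor>t\<rfloor>"
  have "real n \<le> t" "t < real n + 1" using \<open>0 \<le> t\<close> by (auto simp: n_def)
  then show ?thesis using shift[of "t - real n" n] by (simp add: B_def)
qed

context brownian_motion
begin

text \<open>
  One random variable \<open>A\<close> serves both purposes: it controls the path on the whole interval, which
  starts the iteration for times in \<open>[0, 1]\<close>, and it is the error of the contraction step.
\<close>

lemma path_step_bounds:
  assumes path: "damped_path g (\<lambda>t. Y t \<omega>) (\<lambda>t. \<sigma> * (W t \<omega> - W 0 \<omega>)) C l"
    and cont: "continuous_on {0..} (\<lambda>t. W t \<omega>)"
    and "0 \<le> a" "even q" "0 < q"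
  obtains A where "0 \<le> A" "Y (a + 1) \<omega> \<le> 1 / (1 + l) * Y a \<omega> + A"
    "\<And>u. u \<in> {a..a + 1} \<Longrightarrow> Y u \<omega> \<le> Y a \<omega> + A"
    "ennreal (A ^ q) \<le> ennreal (2 ^ q * (1 + C) ^ q)
       + ennreal (2 ^ q * (8 * \<bar>\<sigma>\<bar>) ^ q) * dyadic_functional q a \<omega>"
proof -
  interpret damped_path g "\<lambda>t. Y t \<omega>" "\<lambda>t. \<sigma> * (W t \<omega> - W 0 \<omega>)" C l by (rule path)
  have cont': "continuous_on {a..a + 1} (\<lambda>t. W t \<omega>)"
    by (rule continuous_on_subset[OF cont]) (use \<open>0 \<le> a\<close> in auto)
  then have "continuous_on {a..a + 1} (\<lambda>t. \<bar>W t \<omega> - W a \<omega>\<bar>)"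
    by (intro continuous_intros)
  then obtain s where s: "s \<in> {a..a + 1}"
    and max: "\<And>r. r \<in> {a..a + 1} \<Longrightarrow> \<bar>W r \<omega> - W a \<omega>\<bar> \<le> \<bar>W s \<omega> - W a \<omega>\<bar>"
    using continuous_attains_sup[of "{a..a + 1}" "\<lambda>t. \<bar>W t \<omega> - W a \<omega>\<bar>"] by auto
  define v where "v = \<bar>W s \<omega> - W a \<omega>\<bar>"
  have noise: "\<bar>\<sigma> * (W r \<omega> - W 0 \<omega>) - \<sigma> * (W a \<omega> - W 0 \<omega>)\<bar> \<le> \<bar>\<sigma>\<bar> * v"
    if "r \<in> {a..a + 1}" for r
    using mult_left_mono[OF max[OF that], of "\<bar>\<sigma>\<bar>"]
    by (simp add: v_def algebra_simps flip: abs_mult)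
  \<comment> \<open>The oscillation enters the dyadic functional as \<open>v / 4\<close>, hence \<open>2 \<bar>\<sigma>\<bar> v\<close> is read as \<open>8 \<bar>\<sigma>\<bar> (v / 4)\<close>.\<close>
  define A where "A = 1 + C + 2 * (\<bar>\<sigma>\<bar> * v)"
  have "A ^ q = ((1 + C) + (8 * \<bar>\<sigma>\<bar>) * (v / 4)) ^ q"
    by (simp add: A_def mult.commute)
  also have "\<dots> \<le> 2 ^ q * ((1 + C) ^ q + ((8 * \<bar>\<sigma>\<bar>) * (v / 4)) ^ q)"
    by (rule power_add_le[OF \<open>even q\<close>])
  also have "\<dots> = 2 ^ q * (1 + C) ^ q + 2 ^ q * (8 * \<bar>\<sigma>\<bar>) ^ q * (v / 4) ^ q"
    unfolding power_mult_distrib[of "8 * \<bar>\<sigma>\<bar>"] by (simp only: distrib_left mult.assoc)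
  finally have "ennreal (A ^ q)
      \<le> ennreal (2 ^ q * (1 + C) ^ q + 2 ^ q * (8 * \<bar>\<sigma>\<bar>) ^ q * (v / 4) ^ q)"
    by (rule ennreal_leI)
  also have "\<dots> = ennreal (2 ^ q * (1 + C) ^ q)
      + ennreal (2 ^ q * (8 * \<bar>\<sigma>\<bar>) ^ q) * ennreal ((v / 4) ^ q)"
    using C_nonneg by (subst ennreal_plus) (auto simp: v_def ennreal_mult)
  also have "\<dots> \<le> ennreal (2 ^ q * (1 + C) ^ q)
      + ennreal (2 ^ q * (8 * \<bar>\<sigma>\<bar>) ^ q) * dyadic_functional q a \<omega>"
    unfolding v_def
    by (intro add_left_mono mult_left_mono
        oscillation_le_dyadic_functional[OF cont' s \<open>even q\<close> \<open>0 < q\<close>]) auto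
  finally have A_pow: "ennreal (A ^ q) \<le> ennreal (2 ^ q * (1 + C) ^ q)
      + ennreal (2 ^ q * (8 * \<bar>\<sigma>\<bar>) ^ q) * dyadic_functional q a \<omega>" .
  show thesis
  proof (rule that[OF _ _ _ A_pow])
    show "0 \<le> A" using C_nonneg by (simp add: A_def v_def)
    show "Y (a + 1) \<omega> \<le> 1 / (1 + l) * Y a \<omega> + A"
      unfolding A_def by (rule unit_step_contraction[OF \<open>0 \<le> a\<close> noise])
    show "Y u \<omega> \<le> Y a \<omega> + A" if "u \<in> {a..a + 1}" for u
      unfolding A_def by (rule unit_interval_bound[OF \<open>0 \<le> a\<close> noise that])
  qed
qed

text \<open>
  Convexity separates the \<open>q\<close>-th powers of \<open>Y t\<close> and of the error on \<open>[t, t + 1]\<close>, so the moments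
  satisfy the same kind of recursion as the paths.
\<close>

lemma damped_even_moments_bounded:
  assumes meas: "\<And>t. 0 \<le> t \<Longrightarrow> Y t \<in> borel_measurable M"
    and path: "AE \<omega> in M. damped_path g (\<lambda>t. Y t \<omega>) (\<lambda>t. \<sigma> * (W t \<omega> - W 0 \<omega>)) C l"
    and start: "AE \<omega> in M. Y 0 \<omega> = y0"
    and "0 \<le> C" "0 < l" "6 \<le> m"
  obtains B where "\<And>t. 0 \<le> t \<Longrightarrow> (\<integral>\<^sup>+ \<omega>. ennreal (Y t \<omega> ^ (2 * m)) \<partial>M) \<le> ennreal B"
proof -
  define q where "q = 2 * m"
  have q: "even q" "0 < q" using \<open>6 \<le> m\<close> by (auto simp: q_def)
  define \<rho> where "\<rho> = 1 / (1 + l)"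
  have \<rho>: "0 < \<rho>" "\<rho> < 1" using \<open>0 < l\<close> by (auto simp: \<rho>_def)
  define N where "N a \<omega> = ennreal (2 ^ q * (1 + C) ^ q)
       + ennreal (2 ^ q * (8 * \<bar>\<sigma>\<bar>) ^ q) * dyadic_functional q a \<omega>" for a \<omega>
  have N_meas: "N a \<in> borel_measurable M" if "0 \<le> a" for a
    using dyadic_functional_measurable[OF that, of q] unfolding N_def[abs_def] by measurable
  define D :: real where "D = fact (2 * m) / (2 ^ m * fact m) * (1 / (1 - 2 * (8 / 9) ^ m))"
  define H where "H = 2 ^ q * (1 + C) ^ q + 2 ^ q * (8 * \<bar>\<sigma>\<bar>) ^ q * max 0 D"
  have H: "0 \<le> H" using \<open>0 \<le> C\<close> by (simp add: H_def)
  have N_int: "(\<integral>\<^sup>+ \<omega>. N a \<omega> \<partial>M) \<le> ennreal H" if "0 \<le> a" for a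
  proof -
    have "(\<integral>\<^sup>+ \<omega>. N a \<omega> \<partial>M) = ennreal (2 ^ q * (1 + C) ^ q)
       + ennreal (2 ^ q * (8 * \<bar>\<sigma>\<bar>) ^ q) * (\<integral>\<^sup>+ \<omega>. dyadic_functional q a \<omega> \<partial>M)"
      unfolding N_def using dyadic_functional_measurable[OF that, of q]
      by (simp add: nn_integral_add nn_integral_cmult emeasure_space_1)
    also have "\<dots> \<le> ennreal (2 ^ q * (1 + C) ^ q)
       + ennreal (2 ^ q * (8 * \<bar>\<sigma>\<bar>) ^ q) * ennreal (max 0 D)"
      using nn_integral_dyadic_functional[OF that \<open>6 \<le> m\<close>]
      by (intro add_left_mono mult_left_mono) (auto simp: D_def q_def max_def ennreal_neg)
    also have "\<dots> = ennreal H"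
      using \<open>0 \<le> C\<close> by (simp add: H_def ennreal_mult)
    finally show ?thesis .
  qed
  have good: "AE \<omega> in M. damped_path g (\<lambda>t. Y t \<omega>) (\<lambda>t. \<sigma> * (W t \<omega> - W 0 \<omega>)) C l
      \<and> continuous_on {0..} (\<lambda>t. W t \<omega>) \<and> Y 0 \<omega> = y0"
    using path start continuous_W by eventually_elim simp
  define \<phi> where "\<phi> t = (\<integral>\<^sup>+ \<omega>. ennreal (Y t \<omega> ^ q) \<partial>M)" for t
  define K where "K = 2 ^ q * (y0 ^ q + H) + (1 - \<rho>) * (1 / (1 - \<rho>)) ^ q * H"
  have K: "2 ^ q * (y0 ^ q + H) \<le> K" "(1 - \<rho>) * (1 / (1 - \<rho>)) ^ q * H \<le> K" "0 \<le> K"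
    using \<rho> H q(1) unfolding K_def by (auto simp: zero_le_even_power intro!: add_nonneg_nonneg mult_nonneg_nonneg)
  have "\<phi> t \<le> ennreal (K / (1 - \<rho>))" if "0 \<le> t" for t
  proof (rule bounded_of_contraction[OF _ \<rho>(2) K(3) _ _ that])
    fix t :: real assume t: "t \<in> {0..1}"
    have "\<phi> t \<le> (\<integral>\<^sup>+ \<omega>. ennreal (2 ^ q * y0 ^ q) + ennreal (2 ^ q) * N 0 \<omega> \<partial>M)"
      unfolding \<phi>_def
    proof (rule nn_integral_mono_AE, use good in eventually_elim)
      fix \<omega>
      assume *: "damped_path g (\<lambda>t. Y t \<omega>) (\<lambda>t. \<sigma> * (W t \<omega> - W 0 \<omega>)) C l
        \<and> continuous_on {0..} (\<lambda>t. W t \<omega>) \<and> Y 0 \<omega> = y0"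
      then obtain A where A: "0 \<le> A" "Y t \<omega> \<le> y0 + A" "ennreal (A ^ q) \<le> N 0 \<omega>"
        using t path_step_bounds[of g Y \<omega> \<sigma> C l 0 q] q unfolding N_def by (smt (verit) atLeastAtMost_iff)
      have "Y t \<omega> ^ q \<le> (y0 + A) ^ q"
        using A * t by (intro power_mono) (auto intro: less_imp_le damped_path.y_pos)
      also have "\<dots> \<le> 2 ^ q * y0 ^ q + 2 ^ q * A ^ q"
        using power_add_le[OF q(1), of y0 A] by (simp add: distrib_left)
      finally have "ennreal (Y t \<omega> ^ q) \<le> ennreal (2 ^ q * y0 ^ q) + ennreal (2 ^ q) * ennreal (A ^ q)"
        using A q(1) by (simp add: zero_le_even_power ennreal_leI flip: ennreal_mult ennreal_plus)
      also have "\<dots> \<le> ennreal (2 ^ q * y0 ^ q) + ennreal (2 ^ q) * N 0 \<omega>"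
        by (intro add_left_mono mult_left_mono A) auto
      finally show "ennreal (Y t \<omega> ^ q) \<le> ennreal (2 ^ q * y0 ^ q) + ennreal (2 ^ q) * N 0 \<omega>" .
    qed
    also have "\<dots> = ennreal (2 ^ q * y0 ^ q) + ennreal (2 ^ q) * (\<integral>\<^sup>+ \<omega>. N 0 \<omega> \<partial>M)"
      using N_meas[of 0] by (simp add: nn_integral_add nn_integral_cmult emeasure_space_1)
    also have "\<dots> \<le> ennreal (2 ^ q * y0 ^ q) + ennreal (2 ^ q) * ennreal H"
      by (intro add_left_mono mult_left_mono N_int) auto
    also have "\<dots> = ennreal (2 ^ q * (y0 ^ q + H))"
      using H q(1) by (simp add: zero_le_even_power distrib_left flip: ennreal_mult ennreal_plus)
    also have "\<dots> \<le> ennreal K" using K by (intro ennreal_leI)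
    finally show "\<phi> t \<le> ennreal K" .
  next
    fix t :: real assume t: "0 \<le> t"
    let ?c = "(1 - \<rho>) * (1 / (1 - \<rho>)) ^ q"
    have c: "0 \<le> ?c" using \<rho> by simp
    have "\<phi> (t + 1) \<le> (\<integral>\<^sup>+ \<omega>. ennreal \<rho> * ennreal (Y t \<omega> ^ q) + ennreal ?c * N t \<omega> \<partial>M)"
      unfolding \<phi>_def
    proof (rule nn_integral_mono_AE, use good in eventually_elim)
      fix \<omega>
      assume *: "damped_path g (\<lambda>t. Y t \<omega>) (\<lambda>t. \<sigma> * (W t \<omega> - W 0 \<omega>)) C l
        \<and> continuous_on {0..} (\<lambda>t. W t \<omega>) \<and> Y 0 \<omega> = y0"
      then obtain A where A: "0 \<le> A" "Y (t + 1) \<omega> \<le> \<rho> * Y t \<omega> + A" "ennreal (A ^ q) \<le> N t \<omega>"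
        using t path_step_bounds[of g Y \<omega> \<sigma> C l t q] q unfolding N_def \<rho>_def by metis
      have "0 < Y (t + 1) \<omega>" using damped_path.y_pos[of _ _ _ _ _ "t + 1"] * t by auto
      then have "Y (t + 1) \<omega> ^ q \<le> (\<rho> * Y t \<omega> + A) ^ q"
        using A by (intro power_mono) auto
      also have "\<dots> \<le> \<rho> * Y t \<omega> ^ q + ?c * A ^ q"
        using convexity_split[OF \<rho> q(1), of "Y t \<omega>" A] by (simp add: power_divide)
      finally have "ennreal (Y (t + 1) \<omega> ^ q)
          \<le> ennreal \<rho> * ennreal (Y t \<omega> ^ q) + ennreal ?c * ennreal (A ^ q)"
        using A q(1) \<rho> c by (simp add: zero_le_even_power ennreal_leI flip: ennreal_mult ennreal_plus)
      also have "\<dots> \<le> ennreal \<rho> * ennreal (Y t \<omega> ^ q) + ennreal ?c * N t \<omega>"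
        by (intro add_left_mono mult_left_mono A) auto
      finally show "ennreal (Y (t + 1) \<omega> ^ q)
          \<le> ennreal \<rho> * ennreal (Y t \<omega> ^ q) + ennreal ?c * N t \<omega>" .
    qed
    also have "\<dots> = ennreal \<rho> * \<phi> t + ennreal ?c * (\<integral>\<^sup>+ \<omega>. N t \<omega> \<partial>M)"
      unfolding \<phi>_def using N_meas[OF t] meas[OF t]
      by (simp add: nn_integral_add nn_integral_cmult)
    also have "\<dots> \<le> ennreal \<rho> * \<phi> t + ennreal ?c * ennreal H"
      by (intro add_left_mono mult_left_mono N_int t) auto
    also have "ennreal ?c * ennreal H = ennreal (?c * H)"
      using c H by (simp add: ennreal_mult)
    also have "ennreal \<rho> * \<phi> t + \<dots> \<le> ennreal \<rho> * \<phi> t + ennreal K"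
      by (intro add_left_mono ennreal_leI K)
    finally show "\<phi> (t + 1) \<le> ennreal \<rho> * \<phi> t + ennreal K" .
  qed (use \<rho> in simp)
  then show thesis using that unfolding \<phi>_def q_def by blast
qed

end

theorem lemma2:
  fixes M :: "'a measure" and F :: "real \<Rightarrow> 'a measure"
    and W Y :: "real \<Rightarrow> 'a \<Rightarrow> real"
    and am1 a0 a1 a2 b \<gamma> \<theta> x0 p :: real
  assumes "usual_filtered_prob_space M F"
    and "brownian_motion M F W"
    and "am1 > 0" and "a0 > 0" and "a1 > 0" and "a2 > 0" and "b > 0"
    and "\<gamma> > 1" and "\<theta> > 1" and "\<gamma> + 1 \<ge> 2 * \<theta>"
    and "x0 > 0"
    and "positive_global_solution M F W (drift am1 a0 a1 a2 b \<gamma> \<theta>) (b * (1 - \<theta>))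
           (x0 powr (1 - \<theta>)) Y"
    and "p \<ge> (\<gamma> - 1) / (\<theta> - 1)"
  shows "(SUP t\<in>{0..}. \<integral>\<^sup>+ \<omega>. ennreal (\<bar>Y t \<omega>\<bar> powr p) \<partial>M) < \<infinity>"
proof -
  interpret brownian_motion M F W by (rule assms)
  have p: "0 \<le> p"
    using assms(8,9,13) by (meson divide_nonneg_pos diff_ge_0_iff_ge diff_gt_0_iff_gt less_imp_le order_trans)
  \<comment> \<open>It suffices to bound one even moment of order at least \<open>p\<close>.\<close>
  obtain m :: nat where m: "6 \<le> m" "p \<le> real (2 * m)"
  proof
    show "p \<le> real (2 * max 6 (nat \<lceil>p\<rceil>))" using p by linarith
  qed simp
  have "\<gamma> \<ge> \<theta>" using assms(9,10) by linarith
  then obtain C where C: "0 \<le> C" "\<And>x. 1 \<le> x \<Longrightarrow>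
      drift am1 a0 a1 a2 b \<gamma> \<theta> x \<le> C - (\<theta> - 1) * a1 * x"
    using drift_le_linear[OF assms(3,4,6,9)] by metis
  have l: "0 < (\<theta> - 1) * a1" using assms(5,9) by simp
  note sol = assms(12)[unfolded positive_global_solution_def]
  have meas: "Y t \<in> borel_measurable M" if "0 \<le> t" for t
    using sol subalgebra_F[OF that] that measurable_from_subalg unfolding adapted_def by blast
  have path: "AE \<omega> in M. damped_path (drift am1 a0 a1 a2 b \<gamma> \<theta>) (\<lambda>t. Y t \<omega>)
      (\<lambda>t. b * (1 - \<theta>) * (W t \<omega> - W 0 \<omega>)) C ((\<theta> - 1) * a1)"
    using conjunct2[OF sol]
  proof eventually_elim
    case (elim \<omega>)
    show ?case
    proof
      show "0 \<le> C" "0 \<le> (\<theta> - 1) * a1" using C(1) l by auto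
    qed (use elim C(2) in blast)+
  qed
  have start: "AE \<omega> in M. Y 0 \<omega> = x0 powr (1 - \<theta>)"
    using conjunct2[OF sol] by eventually_elim (rule conjunct1)
  obtain B where B: "\<And>t. 0 \<le> t \<Longrightarrow> (\<integral>\<^sup>+ \<omega>. ennreal (Y t \<omega> ^ (2 * m)) \<partial>M) \<le> ennreal B"
    using damped_even_moments_bounded[OF meas path start C(1) l m(1)] by blast
  have "(\<integral>\<^sup>+ \<omega>. ennreal (\<bar>Y t \<omega>\<bar> powr p) \<partial>M) \<le> 1 + ennreal B" if t: "0 \<le> t" for t
  proof -
    have "(\<integral>\<^sup>+ \<omega>. ennreal (\<bar>Y t \<omega>\<bar> powr p) \<partial>M) \<le> (\<integral>\<^sup>+ \<omega>. 1 + ennreal (Y t \<omega> ^ (2 * m)) \<partial>M)"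
    proof (rule nn_integral_mono)
      fix \<omega>
      have "\<bar>Y t \<omega>\<bar> powr p \<le> 1 + Y t \<omega> ^ (2 * m)"
      proof (cases "\<bar>Y t \<omega>\<bar> \<le> 1")
        case True
        then have "\<bar>Y t \<omega>\<bar> powr p \<le> 1" using p by (simp add: powr_le1)
        then show ?thesis by (simp add: power_mult add_increasing2)
      next
        case False
        then have "\<bar>Y t \<omega>\<bar> powr p \<le> \<bar>Y t \<omega>\<bar> powr real (2 * m)"
          using m by (intro powr_mono) auto
        also have "\<dots> = \<bar>Y t \<omega>\<bar> ^ (2 * m)" using False by (intro powr_realpow) auto
        finally show ?thesis by (simp add: power_even_abs)
      qed
      then have "ennreal (\<bar>Y t \<omega>\<bar> powr p) \<le> ennreal (1 + Y t \<omega> ^ (2 * m))"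
        by (rule ennreal_leI)
      then show "ennreal (\<bar>Y t \<omega>\<bar> powr p) \<le> 1 + ennreal (Y t \<omega> ^ (2 * m))"
        by (simp add: zero_le_even_power)
    qed
    also have "\<dots> = 1 + (\<integral>\<^sup>+ \<omega>. ennreal (Y t \<omega> ^ (2 * m)) \<partial>M)"
      using meas[OF t] by (simp add: nn_integral_add emeasure_space_1)
    also have "\<dots> \<le> 1 + ennreal B" by (intro add_left_mono B t)
    finally show ?thesis .
  qed
  then have "(SUP t\<in>{0..}. \<integral>\<^sup>+ \<omega>. ennreal (\<bar>Y t \<omega>\<bar> powr p) \<partial>M) \<le> 1 + ennreal B"
    by (intro SUP_least) auto
  also have "\<dots> < \<infinity>" by (simp add: ennreal_add_less_top)
  finally show ?thesis .
qed

end
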